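(* Let $(X_{it})$ be a real-valued field whose rows $(X_{it})_{t\in\mathbb{Z}}$, $i=1,2,\ldots$, are iid strictly stationary $m$-dependent sequences (for some $m\ge 1$), let $p=p_n\to\infty$ be a sequence of positive integers, and set $S_{ij}^{(n)}=\sum_{t=1}^nX_{it}X_{jt}$, $i,j=1,\ldots,p$. Let $X$ be a generic element of the field, with distribution $F$, and let $(X_i)$ be an iid sequence with common distribution $F$. Assume the following conditions. (i) The distribution of $X^2$ is in $\mathrm{MDA}(\Lambda)$, i.e. there exist constants $c_n>0$ and $d_n\in\mathbb{R}$ such that $c_n^{-1}\big(\max_{i=1,\ldots,n}X_i^2-d_n\big)\to Y$ in distribution, where $Y$ has the standard Gumbel distribution $\Lambda(x)=e^{-e^{-x}}$, $x\in\mathbb{R}$. (ii) As $n\to\infty$, for every $x\in\mathbb{R}$, $$\mathbb{P}\big(S_{11}^{(n)}-n\,\mathbb{E}[X^2]>c_{np}x+d_{np}\big)\sim n\,\mathbb{P}(X^2>c_{np}x+d_{np}).$$ (iii) For every $x\in\mathbb{R}$ there is a constant $c>0$ such that $$\mathbb{P}\big(S_{12}^{(n)}-n(\mathbb{E}[X])^2>c_{np}x+d_{np}\big)\le c\,n\,\mathbb{P}(X_1X_2>c_{np}x+d_{np})=o(p^{-2}),\qquad n\to\infty.$$ Then, as $n\to\infty$, $$c_{np}^{-1}\max_{1\le i<j\le p}\Big(\big(S_{ij}^{(n)}-n(\mathbb{E}[X])^2\big)-d_{np}\Big)\to-\infty\quad\text{in probability},$$ $$c_{np}^{-1}\max_{i=1,\ldots,p}\Big(\big(S_{ii}^{(n)}-n\,\mathbb{E}[X^2]\big)-d_{np}\Big)\to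 Y\quad\text{in distribution}.$$
   Context: $S_{ij}^{(n)}$ are the entries of the sample covariance matrix $\mathbf X\mathbf X^\top$ of $\mathbf X=(X_{it})_{i=1,\ldots,p;\,t=1,\ldots,n}$; $c_{np}$, $d_{np}$ denote the elements of the sequences $(c_k)$, $(d_k)$ with index $k=n\,p_n$. $a_n\sim b_n$ means $a_n/b_n\to1$. $\mathrm{MDA}(\Lambda)$ is the maximum domain of attraction of the Gumbel distribution. $V_n\to-\infty$ in probability means $\mathbb{P}(V_n>x)\to0$ for every $x\in\mathbb{R}$. A sequence is $m$-dependent if its parts up to time $k$ and after time $k+m$ are independent for every $k$. *)

theory Defs
  imports "HOL-Probability.Probability" "HOL-Library.Landau_Symbols"
begin

definition std_gumbel :: "real measure" where
  "std_gumbel = interval_measure (\<lambda>x. exp (- exp (- x)))"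

lemma
  shows real_distribution_std_gumbel: "real_distribution std_gumbel"
    and cdf_std_gumbel: "cdf std_gumbel x = exp (- exp (- x))"
proof -
  let ?G = "\<lambda>x::real. exp (- exp (- x))"
  have mono: "?G x \<le> ?G y" if "x \<le> y" for x y
    using that by simp
  have right_cont: "continuous (at_right a) ?G" for a
    by (intro continuous_intros)
  have bot: "(?G \<longlongrightarrow> 0) at_bot"
    by (intro filterlim_compose[OF exp_at_bot] filterlim_compose[OF filterlim_uminus_at_bot_at_top]
        filterlim_compose[OF exp_at_top] filterlim_uminus_at_top_at_bot)
  have top: "(?G \<longlongrightarrow> 1) at_top"
  proof -
    have "((\<lambda>x::real. exp (- x)) \<longlongrightarrow> 0) at_top"
      by (rule filterlim_compose[OF exp_at_bot filterlim_uminus_at_bot_at_top])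
    then have "(?G \<longlongrightarrow> exp (- 0)) at_top"
      by (intro tendsto_intros)
    then show ?thesis
      by simp
  qed
  show "real_distribution std_gumbel"
    unfolding std_gumbel_def
    by (rule real_distribution_interval_measure[OF mono right_cont bot top])
  show "cdf std_gumbel x = exp (- exp (- x))"
    unfolding std_gumbel_def
    by (simp add: cdf_interval_measure[OF mono right_cont bot])
qed

definition trajectory :: "(int \<Rightarrow> 'a \<Rightarrow> real) \<Rightarrow> int set \<Rightarrow> 'a \<Rightarrow> int \<Rightarrow> real" where
  "trajectory Z T = (\<lambda>\<omega>. \<lambda>t\<in>T. Z t \<omega>)"

abbreviation path_space :: "int set \<Rightarrow> (int \<Rightarrow> real) measure" where
  "path_space T \<equiv> PiM T (\<lambda>_. borel)"

text \<open>Rows are indexed by \<open>1, 2, \<dots>\<close>; nothing is assumed about \<open>X 0\<close>.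
  Measurability of the entries is part of \<open>indep_vars\<close>.\<close>

definition iid_rows :: "'a measure \<Rightarrow> (nat \<Rightarrow> int \<Rightarrow> 'a \<Rightarrow> real) \<Rightarrow> bool" where
  "iid_rows M X \<longleftrightarrow>
     prob_space.indep_vars M (\<lambda>_. path_space UNIV) (\<lambda>i. trajectory (X i) UNIV) {1..} \<and>
     (\<forall>i\<ge>1. \<forall>j\<ge>1. distr M (path_space UNIV) (trajectory (X i) UNIV)
                    = distr M (path_space UNIV) (trajectory (X j) UNIV))"

definition strictly_stationary :: "'a measure \<Rightarrow> (int \<Rightarrow> 'a \<Rightarrow> real) \<Rightarrow> bool" where
  "strictly_stationary M Z \<longleftrightarrow>
     (\<forall>h. distr M (path_space UNIV) (trajectory (\<lambda>t. Z (t + h)) UNIV)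
         = distr M (path_space UNIV) (trajectory Z UNIV))"

definition m_dependent :: "'a measure \<Rightarrow> nat \<Rightarrow> (int \<Rightarrow> 'a \<Rightarrow> real) \<Rightarrow> bool" where
  "m_dependent M m Z \<longleftrightarrow>
     (\<forall>k. prob_space.indep_var M (path_space {..k}) (trajectory Z {..k})
            (path_space {k + int m<..}) (trajectory Z {k + int m<..}))"

text \<open>The entry \<open>(i, j)\<close> of the (unnormalised) sample covariance matrix.\<close>

definition sample_cov :: "(nat \<Rightarrow> int \<Rightarrow> 'a \<Rightarrow> real) \<Rightarrow> nat \<Rightarrow> nat \<Rightarrow> nat \<Rightarrow> 'a \<Rightarrow> real" where
  "sample_cov X n i j \<omega> = (\<Sum>t = 1..int n. X i t \<omega> * X j t \<omega>)"

definition minus_infty_in_prob :: "'a measure \<Rightarrow> (nat \<Rightarrow> 'a \<Rightarrow> real) \<Rightarrow> bool" where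
  "minus_infty_in_prob M V \<longleftrightarrow> (\<forall>x. (\<lambda>n. \<P>(\<omega> in M. V n \<omega> > x)) \<longlonglongrightarrow> 0)"

end

theory Submission
  imports Defs
begin

text \<open>
  For an iid sequence, the probability that the first \<open>k\<close> members stay below \<open>u\<close> is \<open>(1 - q) ^ k\<close>,
  where \<open>q\<close> is the probability that one member exceeds \<open>u\<close>. When \<open>k\<close> tends to infinity, this power
  tends to \<open>exp (- l)\<close> precisely when the expected number \<open>k * q\<close> of exceedances tends to \<open>l\<close>
  (\<open>power_one_minus_tendsto_exp_iff\<close>). Convergence of a normalised maximum to the Gumbel law is
  therefore a statement about one tail probability, and it is used twice in opposite directions.
  The domain of attraction hypothesis, along the indices \<open>n * p n\<close>, says that
  \<open>n * p n\<close> times the tail of \<open>X\<^sup>2\<close> at level \<open>c * x + d\<close> tends to \<open>exp (- x)\<close>. The large deviation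
  hypothesis on the diagonal trades \<open>n\<close> times this tail for the tail of the centred \<open>S\<^sub>1\<^sub>1\<close>, so \<open>p n\<close> times the
  latter tail tends to \<open>exp (- x)\<close> as well. The \<open>S\<^sub>i\<^sub>i\<close> are iid because they are the same
  functional of the iid rows, and the limit law of their maximum follows.

  Off the diagonal the entries are dependent, but a union bound suffices
  (\<open>prob_Max_offdiagonal_le\<close>): all \<open>S\<^sub>i\<^sub>j\<close> with \<open>i < j\<close> have the law of \<open>S\<^sub>1\<^sub>2\<close>, because two
  distinct rows always have the same joint law; there are at most \<open>(p n)\<^sup>2\<close> of them, and one alone,
  centred, exceeds the level with probability \<open>o (1 / (p n)\<^sup>2)\<close>.
\<close>

section \<open>Maxima of iid sequences and exceedance counts\<close>

text \<open>
  In both directions the hypothesis forces \<open>q\<close> to tend to \<open>0\<close>, where \<open>- ln (1 - q)\<close> is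
  asymptotically \<open>q\<close>; the claim is then a comparison of \<open>k * ln (1 - q)\<close> with \<open>- (k * q)\<close>.
\<close>

lemma power_one_minus_tendsto_exp_iff:
  fixes q :: "'i \<Rightarrow> real" and k :: "'i \<Rightarrow> nat"
  assumes k: "filterlim k at_top G"
    and q0: "\<And>n. 0 \<le> q n" and q1: "\<And>n. q n \<le> 1"
  shows "((\<lambda>n. (1 - q n) ^ k n) \<longlongrightarrow> exp (- l)) G \<longleftrightarrow> ((\<lambda>n. real (k n) * q n) \<longlongrightarrow> l) G"
proof -
  have k_real: "filterlim (\<lambda>n. real (k n)) at_top G"
    by (rule filterlim_compose[OF filterlim_real_sequentially k])
  have k_pos: "\<forall>\<^sub>F n in G. 0 < k n"
    using k by (metis eventually_gt_at_top filterlim_iff)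
  \<comment> \<open>the ratio of \<open>- ln (1 - q)\<close> to \<open>q\<close>, continued by its limit at \<open>q = 0\<close>\<close>
  define r where "r n = (if q n = 0 then 1 else - ln (1 - q n) / q n)" for n
  have ln_eq: "ln (1 - q n) = - (q n * r n)" for n
    by (simp add: r_def)
  have r_lim: "(r \<longlongrightarrow> 1) G" and small: "\<forall>\<^sub>F n in G. q n < 1/2 \<and> 1 \<le> r n"
    if "(q \<longlongrightarrow> 0) G"
  proof -
    have ev: "\<forall>\<^sub>F n in G. q n < 1/2"
      using order_tendstoD(2)[OF that, of "1/2"] by simp
    have bounds: "1 \<le> r n \<and> r n \<le> 1 + 2 * q n" if "q n < 1/2" for n
    proof (cases "q n = 0")
      case False
      then have "q n > 0" using q0[of n] by simp
      moreover have "ln (1 - q n) \<le> - q n"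
        using ln_one_minus_pos_upper_bound[of "q n"] q0[of n] that by simp
      moreover have "- q n - 2 * (q n)\<^sup>2 \<le> ln (1 - q n)"
        using ln_one_minus_pos_lower_bound[of "q n"] q0[of n] that by simp
      ultimately show ?thesis
        by (simp add: r_def field_simps power2_eq_square)
    qed (simp add: r_def)
    show "\<forall>\<^sub>F n in G. q n < 1/2 \<and> 1 \<le> r n"
      using ev by eventually_elim (use bounds in blast)
    show "(r \<longlongrightarrow> 1) G"
    proof (rule tendsto_sandwich)
      show "\<forall>\<^sub>F n in G. 1 \<le> r n"
        using ev by eventually_elim (use bounds in blast)
      show "\<forall>\<^sub>F n in G. r n \<le> 1 + 2 * q n"
        using ev by eventually_elim (use bounds in blast)
      show "((\<lambda>n. 1 + 2 * q n) \<longlongrightarrow> 1) G"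
        using tendsto_add[OF tendsto_const tendsto_mult[OF tendsto_const that], of 1 2] by simp
    qed simp
  qed
  have power_eq: "(1 - q n) ^ k n = exp (real (k n) * ln (1 - q n))" if "q n < 1" for n
    using that by (simp add: exp_of_nat_mult)
  show ?thesis
  proof
    assume lim: "((\<lambda>n. (1 - q n) ^ k n) \<longlongrightarrow> exp (- l)) G"
    have "\<forall>\<^sub>F n in G. 0 < (1 - q n) ^ k n"
      by (rule order_tendstoD(1)[OF lim]) simp
    \<comment> \<open>if \<open>q n\<close> were \<open>1\<close>, the power would vanish, as \<open>k n > 0\<close>\<close>
    with k_pos have q_lt: "\<forall>\<^sub>F n in G. q n < 1"
    proof eventually_elim
      case (elim n)
      then have "q n \<noteq> 1" by (auto simp: zero_power)
      with q1[of n] show ?case by simp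
    qed
    have "((\<lambda>n. ln ((1 - q n) ^ k n)) \<longlongrightarrow> ln (exp (- l))) G"
      by (intro tendsto_ln lim) simp
    then have log_lim: "((\<lambda>n. real (k n) * ln (1 - q n)) \<longlongrightarrow> - l) G"
      unfolding ln_exp
      by (rule Lim_transform_eventually)
        (use q_lt in eventually_elim, simp add: power_eq)
    have q_lim: "(q \<longlongrightarrow> 0) G"
    proof (rule tendsto_sandwich[where f = "\<lambda>_. 0"])
      show "\<forall>\<^sub>F n in G. q n \<le> - (real (k n) * ln (1 - q n)) / real (k n)"
        using q_lt k_pos
        by eventually_elim (use ln_one_minus_pos_upper_bound q0 in fastforce)
      show "((\<lambda>n. - (real (k n) * ln (1 - q n)) / real (k n)) \<longlongrightarrow> 0) G"
        by (rule real_tendsto_divide_at_top[OF tendsto_minus[OF log_lim] k_real])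
    qed (use q0 in auto)
    have "((\<lambda>n. - (real (k n) * ln (1 - q n)) / r n) \<longlongrightarrow> - (- l) / 1) G"
      by (intro tendsto_intros log_lim r_lim q_lim) simp
    then show "((\<lambda>n. real (k n) * q n) \<longlongrightarrow> l) G"
      unfolding minus_minus div_by_1
      by (rule Lim_transform_eventually)
        (use small[OF q_lim] in eventually_elim, auto simp: ln_eq)
  next
    assume lim: "((\<lambda>n. real (k n) * q n) \<longlongrightarrow> l) G"
    have q_lim: "(q \<longlongrightarrow> 0) G"
      by (rule Lim_transform_eventually[OF real_tendsto_divide_at_top[OF lim k_real]])
        (use k_pos in eventually_elim, simp)
    have "((\<lambda>n. exp (- (real (k n) * q n * r n))) \<longlongrightarrow> exp (- (l * 1))) G"
      by (intro tendsto_intros lim r_lim q_lim)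
    then show "((\<lambda>n. (1 - q n) ^ k n) \<longlongrightarrow> exp (- l)) G"
      unfolding mult_1_right
      by (rule Lim_transform_eventually)
        (use small[OF q_lim] in eventually_elim, auto simp: power_eq ln_eq mult.assoc)
  qed
qed

lemma (in prob_space) prob_Max_iid_le:
  fixes Y :: "nat \<Rightarrow> 'a \<Rightarrow> real"
  assumes indep: "indep_vars (\<lambda>_. borel) Y {1..}"
    and tails: "\<And>i. 1 \<le> i \<Longrightarrow> \<P>(\<omega> in M. Y i \<omega> > u) = q"
    and k: "1 \<le> k"
  shows "\<P>(\<omega> in M. (MAX i\<in>{1..k}. Y i \<omega>) \<le> u) = (1 - q) ^ k"
proof -
  have rv: "random_variable borel (Y i)" if "1 \<le> i" for i
    using indep that by (auto simp: indep_vars_def)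
  have below: "prob (Y i -` {..u} \<inter> space M) = 1 - q" if i: "i \<in> {1..k}" for i
  proof -
    have [measurable]: "random_variable borel (Y i)"
      using rv i by simp
    have "\<P>(\<omega> in M. \<not> Y i \<omega> > u) = 1 - \<P>(\<omega> in M. Y i \<omega> > u)"
      by (rule prob_neg) measurable
    moreover have "{\<omega> \<in> space M. \<not> Y i \<omega> > u} = Y i -` {..u} \<inter> space M"
      by auto
    ultimately show ?thesis
      using tails[of i] i by simp
  qed
  have "{\<omega> \<in> space M. (MAX i\<in>{1..k}. Y i \<omega>) \<le> u} = (\<Inter>i\<in>{1..k}. Y i -` {..u} \<inter> space M)"
    using k by (subst Max_le_iff) auto
  also have "prob \<dots> = (\<Prod>i\<in>{1..k}. prob (Y i -` {..u} \<inter> space M))"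
    by (rule indep_varsD[OF indep]) (use k in auto)
  also have "\<dots> = (1 - q) ^ k"
    using below by simp
  finally show ?thesis .
qed

text \<open>The Gumbel distribution function is continuous, so no point is exempt in the limit.\<close>

lemma weak_conv_m_std_gumbel_iff:
  "weak_conv_m \<mu> std_gumbel \<longleftrightarrow> (\<forall>x. (\<lambda>n. cdf (\<mu> n) x) \<longlonglongrightarrow> exp (- exp (- x)))"
proof -
  have "cdf std_gumbel = (\<lambda>x. exp (- exp (- x)))"
    by (rule ext) (rule cdf_std_gumbel)
  moreover have "isCont (\<lambda>x::real. exp (- exp (- x))) x" for x
    by (intro continuous_intros)
  ultimately show ?thesis
    by (simp add: weak_conv_m_def weak_conv_def)
qed

section \<open>Laws of the entries of the sample covariance matrix\<close>

lemma (in prob_space) indep_vars_distr_pair: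
  assumes indep: "indep_vars (\<lambda>_. S) Y I" and ij: "i \<in> I" "j \<in> I" "i \<noteq> j"
  shows "distr M (S \<Otimes>\<^sub>M S) (\<lambda>\<omega>. (Y i \<omega>, Y j \<omega>)) = distr M S (Y i) \<Otimes>\<^sub>M distr M S (Y j)"
proof -
  have "indep_var S ((\<lambda>f. f i) \<circ> (\<lambda>\<omega>. restrict (\<lambda>i. Y i \<omega>) {i}))
      S ((\<lambda>f. f j) \<circ> (\<lambda>\<omega>. restrict (\<lambda>i. Y i \<omega>) {j}))"
    using ij by (intro indep_var_compose[OF indep_var_restrict[OF indep]]) auto
  then have "indep_var S (Y i) S (Y j)"
    by (simp add: comp_def)
  then show ?thesis
    by (simp add: indep_var_distribution_eq)
qed

text \<open>
  Writing an entry as one measurable functional of a pair of rows lets laws and independence pass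
  from the rows to the entries.
\<close>

definition path_product :: "nat \<Rightarrow> (int \<Rightarrow> real) \<times> (int \<Rightarrow> real) \<Rightarrow> real" where
  "path_product n = (\<lambda>(y, z). \<Sum>t = 1..int n. y t * z t)"

lemma sample_cov_eq_path_product:
  "sample_cov X n i j \<omega> = path_product n (trajectory (X i) UNIV \<omega>, trajectory (X j) UNIV \<omega>)"
  by (simp add: sample_cov_def path_product_def trajectory_def)

lemma measurable_path_product [measurable]:
  "path_product n \<in> borel_measurable (path_space UNIV \<Otimes>\<^sub>M path_space UNIV)"
  unfolding path_product_def by measurable

context prob_space
begin

lemma
  assumes "iid_rows M X"
  shows iid_rows_indep: "indep_vars (\<lambda>_. path_space UNIV) (\<lambda>i. trajectory (X i) UNIV) {1..}"
    and iid_rows_same_law: "\<And>i j. 1 \<le> i \<Longrightarrow> 1 \<le> j \<Longrightarrow>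
      distr M (path_space UNIV) (trajectory (X i) UNIV) = distr M (path_space UNIV) (trajectory (X j) UNIV)"
  using assms unfolding iid_rows_def by blast+

lemma iid_rows_imp_indep_vars_diagonal:
  assumes "iid_rows M X"
  shows "indep_vars (\<lambda>_. borel) (\<lambda>i \<omega>. sample_cov X n i i \<omega> - a) {1..}"
  unfolding sample_cov_eq_path_product
  using iid_rows_indep[OF assms]
  by (rule indep_vars_compose2[where Y = "\<lambda>_ y. path_product n (y, y) - a"
        and X = "\<lambda>i. trajectory (X i) UNIV" and M' = "\<lambda>_. path_space UNIV"]) measurable

lemma measurable_trajectory_iid_rows:
  assumes "iid_rows M X" "1 \<le> i"
  shows "random_variable (path_space UNIV) (trajectory (X i) UNIV)"
  using iid_rows_indep[OF assms(1)] assms(2) by (simp add: indep_vars_def)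

lemma measurable_sample_cov_iid_rows:
  assumes "iid_rows M X" "1 \<le> i" "1 \<le> j"
  shows "random_variable borel (sample_cov X n i j)"
proof -
  note [measurable] = measurable_trajectory_iid_rows[OF assms(1,2)]
    measurable_trajectory_iid_rows[OF assms(1,3)]
  show ?thesis
    unfolding sample_cov_eq_path_product[abs_def] by measurable
qed

lemma prob_diagonal_sample_cov_eq:
  assumes rows: "iid_rows M X" and i: "1 \<le> i"
  shows "\<P>(\<omega> in M. sample_cov X n i i \<omega> > u) = \<P>(\<omega> in M. sample_cov X n 1 1 \<omega> > u)"
proof -
  let ?A = "{y \<in> space (path_space UNIV). path_product n (y, y) > u}"
  have A: "?A \<in> sets (path_space UNIV)"
    by measurable
  have law: "\<P>(\<omega> in M. sample_cov X n l l \<omega> > u)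
      = measure (distr M (path_space UNIV) (trajectory (X l) UNIV)) ?A" if "1 \<le> l" for l
    by (subst measure_distr[OF measurable_trajectory_iid_rows[OF rows that] A])
      (auto intro!: arg_cong[where f = prob] simp: sample_cov_eq_path_product space_PiM)
  show ?thesis
    unfolding law[OF i] law[OF order_refl] iid_rows_same_law[OF rows i order_refl] ..
qed

text \<open>
  Independence makes the joint law of two distinct rows a product measure, and equality of the row
  laws makes this product the same for every pair.
\<close>

lemma prob_offdiagonal_sample_cov_eq:
  assumes rows: "iid_rows M X" and ij: "1 \<le> i" "i < j"
  shows "\<P>(\<omega> in M. sample_cov X n i j \<omega> > u) = \<P>(\<omega> in M. sample_cov X n 1 2 \<omega> > u)"
proof -
  let ?P = "path_space UNIV"
  let ?A = "{z \<in> space (?P \<Otimes>\<^sub>M ?P). path_product n z > u}"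
  have A: "?A \<in> sets (?P \<Otimes>\<^sub>M ?P)"
    by measurable
  let ?T = "\<lambda>l. trajectory (X l) UNIV"
  have law: "\<P>(\<omega> in M. sample_cov X n k l \<omega> > u) = measure (distr M ?P (?T k) \<Otimes>\<^sub>M distr M ?P (?T l)) ?A"
    if kl: "1 \<le> k" "k < l" for k l
  proof -
    have [measurable]: "random_variable ?P (?T k)" "random_variable ?P (?T l)"
      using measurable_trajectory_iid_rows[OF rows] kl by auto
    have pair: "random_variable (?P \<Otimes>\<^sub>M ?P) (\<lambda>\<omega>. (?T k \<omega>, ?T l \<omega>))"
      by measurable
    have "distr M ?P (?T k) \<Otimes>\<^sub>M distr M ?P (?T l) = distr M (?P \<Otimes>\<^sub>M ?P) (\<lambda>\<omega>. (?T k \<omega>, ?T l \<omega>))"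
      using kl by (intro indep_vars_distr_pair[OF iid_rows_indep[OF rows], symmetric]) auto
    then show ?thesis
      by (simp only: measure_distr[OF pair A])
        (auto intro!: arg_cong[where f = prob] simp: sample_cov_eq_path_product space_pair_measure space_PiM)
  qed
  have "distr M ?P (?T i) = distr M ?P (?T 1)" "distr M ?P (?T j) = distr M ?P (?T 2)"
    by (rule iid_rows_same_law[OF rows]; use ij in linarith)+
  moreover have "1 < (2 :: nat)"
    by simp
  ultimately show ?thesis
    by (simp only: law[OF ij] law[OF order_refl])
qed

text \<open>
  The union bound over the pairs \<open>i < j\<close>; the crude count \<open>p\<^sup>2\<close> is all that an exceedance
  probability of order \<open>o (1 / p\<^sup>2)\<close> calls for.
\<close>

lemma prob_Max_offdiagonal_le:
  assumes rows: "iid_rows M X" and p: "2 \<le> p"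
  shows "\<P>(\<omega> in M. (MAX (i, j)\<in>{(i, j). 1 \<le> i \<and> i < j \<and> j \<le> p}. sample_cov X n i j \<omega> - a - b) > u)
      \<le> (real p)\<^sup>2 * \<P>(\<omega> in M. sample_cov X n 1 2 \<omega> - a > u + b)"
proof -
  let ?I = "{(i, j). 1 \<le> i \<and> i < j \<and> j \<le> p}"
  let ?E = "\<lambda>(i, j). {\<omega> \<in> space M. sample_cov X n i j \<omega> > u + b + a}"
  have sub: "?I \<subseteq> {1..p} \<times> {1..p}"
    by auto
  then have fin: "finite ?I"
    by (rule finite_subset) simp
  have "(1, 2) \<in> ?I"
    using p by auto
  then have ne: "?I \<noteq> {}"
    by blast
  have card: "card ?I \<le> p * p"
    using card_mono[OF _ sub] by simp
  have ev: "?E z \<in> events" if I: "z \<in> ?I" for z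
  proof -
    obtain i j where z: "z = (i, j)" "1 \<le> i" "1 \<le> j"
      using I by auto
    note [measurable] = measurable_sample_cov_iid_rows[OF rows z(2,3)]
    show ?thesis
      unfolding z(1) by simp
  qed
  have union: "{\<omega> \<in> space M. (MAX (i, j)\<in>?I. sample_cov X n i j \<omega> - a - b) > u} = (\<Union>z\<in>?I. ?E z)"
    using fin ne by (subst Max_gr_iff) (auto simp: algebra_simps)
  have "prob (\<Union>z\<in>?I. ?E z) \<le> (\<Sum>z\<in>?I. prob (?E z))"
    by (rule finite_measure_subadditive_finite) (use fin ev in auto)
  also have "\<dots> = (\<Sum>z\<in>?I. \<P>(\<omega> in M. sample_cov X n 1 2 \<omega> > u + b + a))"
  proof (rule sum.cong[OF refl], clarify)
    fix i j :: nat
    assume "1 \<le> i" "i < j"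
    then show "prob {\<omega> \<in> space M. sample_cov X n i j \<omega> > u + b + a}
        = prob {\<omega> \<in> space M. sample_cov X n 1 2 \<omega> > u + b + a}"
      by (rule prob_offdiagonal_sample_cov_eq[OF rows])
  qed
  also have "\<dots> = real (card ?I) * \<P>(\<omega> in M. sample_cov X n 1 2 \<omega> > u + b + a)"
    by simp
  also have "\<dots> \<le> real (p * p) * \<P>(\<omega> in M. sample_cov X n 1 2 \<omega> > u + b + a)"
    using card by (intro mult_right_mono) (simp_all only: of_nat_le_iff measure_nonneg)
  finally show ?thesis
    unfolding union by (simp add: power2_eq_square less_diff_eq)
qed

end

section \<open>Limits of the largest off-diagonal and diagonal entries\<close>

theorem lemma5p3:
  fixes M :: "'a measure" and X :: "nat \<Rightarrow> int \<Rightarrow> 'a \<Rightarrow> real"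
    and N :: "'b measure" and X\<^sub>g :: "'b \<Rightarrow> real" and \<xi> :: "nat \<Rightarrow> 'b \<Rightarrow> real"
    and F :: "real measure" and m :: nat and p :: "nat \<Rightarrow> nat" and c d :: "nat \<Rightarrow> real"
  assumes M: "prob_space M"
    and m: "m \<ge> 1"
    and rows: "iid_rows M X"
    and stationary: "\<And>i. i \<ge> 1 \<Longrightarrow> strictly_stationary M (X i)"
    and dependence: "\<And>i. i \<ge> 1 \<Longrightarrow> m_dependent M m (X i)"
    and p_pos: "\<And>n. n \<ge> 1 \<Longrightarrow> p n > 0"
    and p_infty: "filterlim p at_top sequentially"
    and F: "F = distr M borel (X 1 1)"
    and N: "prob_space N"
    and generic: "X\<^sub>g \<in> borel_measurable N" "distr N borel X\<^sub>g = F"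
    and \<xi>_indep: "prob_space.indep_vars N (\<lambda>_. borel) \<xi> {1..}"
    and \<xi>_distr: "\<And>i. i \<ge> 1 \<Longrightarrow> distr N borel (\<xi> i) = F"
    and c_pos: "\<And>n. n \<ge> 1 \<Longrightarrow> c n > 0"
    and mda: "weak_conv_m
          (\<lambda>n. distr N borel (\<lambda>\<omega>. inverse (c n) * ((MAX i\<in>{1..n}. (\<xi> i \<omega>)\<^sup>2) - d n)))
          std_gumbel"
    and diag: "\<And>x. (\<lambda>n.
          \<P>(\<omega> in M. sample_cov X n 1 1 \<omega> - real n * (\<integral>\<omega>. (X\<^sub>g \<omega>)\<^sup>2 \<partial>N) > c (n * p n) * x + d (n * p n))
            / (real n * \<P>(\<omega> in N. (X\<^sub>g \<omega>)\<^sup>2 > c (n * p n) * x + d (n * p n)))) \<longlonglongrightarrow> 1"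
    and offdiag: "\<And>x. \<exists>C>0.
          (\<forall>\<^sub>F n in sequentially.
            \<P>(\<omega> in M. sample_cov X n 1 2 \<omega> - real n * (\<integral>\<omega>. X\<^sub>g \<omega> \<partial>N)\<^sup>2 > c (n * p n) * x + d (n * p n))
              \<le> C * real n * \<P>(\<omega> in N. \<xi> 1 \<omega> * \<xi> 2 \<omega> > c (n * p n) * x + d (n * p n))) \<and>
          (\<lambda>n. C * real n * \<P>(\<omega> in N. \<xi> 1 \<omega> * \<xi> 2 \<omega> > c (n * p n) * x + d (n * p n)))
            \<in> o[sequentially](\<lambda>n. inverse ((real (p n))\<^sup>2))"
  shows "minus_infty_in_prob M
          (\<lambda>n \<omega>. inverse (c (n * p n)) *
            (MAX (i, j)\<in>{(i, j). 1 \<le> i \<and> i < j \<and> j \<le> p n}.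
              (sample_cov X n i j \<omega> - real n * (\<integral>\<omega>. X\<^sub>g \<omega> \<partial>N)\<^sup>2) - d (n * p n))) \<and>
        weak_conv_m
          (\<lambda>n. distr M borel (\<lambda>\<omega>. inverse (c (n * p n)) *
            (MAX i\<in>{1..p n}.
              (sample_cov X n i i \<omega> - real n * (\<integral>\<omega>. (X\<^sub>g \<omega>)\<^sup>2 \<partial>N)) - d (n * p n))))
          std_gumbel"
proof -
  interpret M: prob_space M by (rule M)
  interpret N: prob_space N by (rule N)
  let ?k = "\<lambda>n. n * p n"
  let ?u = "\<lambda>x n. c (?k n) * x + d (?k n)"
  have k_infty: "filterlim ?k at_top sequentially"
  proof (rule filterlim_at_top_mono[OF filterlim_ident])
    show "\<forall>\<^sub>F n in sequentially. n \<le> ?k n"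
      using eventually_ge_at_top[of 1] by eventually_elim (use p_pos in fastforce)
  qed
  \<comment> \<open>the normalising constants \<open>c\<close> are known to be positive only at positive indices\<close>
  have k_pos: "\<forall>\<^sub>F n in sequentially. 1 \<le> ?k n"
    by (rule eventually_compose_filterlim[OF eventually_ge_at_top k_infty])
  have p_ge_2: "\<forall>\<^sub>F n in sequentially. 2 \<le> p n"
    by (rule eventually_compose_filterlim[OF eventually_ge_at_top p_infty])

  define tail where "tail y = \<P>(\<omega> in N. (X\<^sub>g \<omega>)\<^sup>2 > y)" for y
  have tail_eq: "\<P>(\<omega> in N. (\<xi> i \<omega>)\<^sup>2 > y) = tail y" if i: "1 \<le> i" for i y
  proof -
    have A: "{z::real. z\<^sup>2 > y} \<in> sets borel"
      by measurable
    have \<xi>_meas: "\<xi> i \<in> borel_measurable N"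
      using \<xi>_indep i by (auto simp: N.indep_vars_def)
    have pull: "\<P>(\<omega> in N. (Z \<omega>)\<^sup>2 > y) = measure (distr N borel Z) {z. z\<^sup>2 > y}"
      if "Z \<in> borel_measurable N" for Z
      by (subst measure_distr[OF that A]) (auto intro!: arg_cong[where f = N.prob])
    show ?thesis
      unfolding tail_def pull[OF \<xi>_meas] pull[OF generic(1)] generic(2) \<xi>_distr[OF i] ..
  qed
  have squares_indep: "N.indep_vars (\<lambda>_. borel) (\<lambda>i \<omega>. (\<xi> i \<omega>)\<^sup>2) {1..}"
    by (rule N.indep_vars_compose2[OF \<xi>_indep]) simp

  have square_tail: "(\<lambda>n. real (?k n) * tail (?u x n)) \<longlonglongrightarrow> exp (- x)" for x
  proof -
    \<comment> \<open>the hypothesis on maxima of squares, read off along the subsequence \<open>n * p n\<close>\<close>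
    let ?cdf = "\<lambda>k. cdf (distr N borel
      (\<lambda>\<omega>. inverse (c k) * ((MAX i\<in>{1..k}. (\<xi> i \<omega>)\<^sup>2) - d k))) x"
    have cdf_eq: "?cdf k = (1 - tail (c k * x + d k)) ^ k" if k: "1 \<le> k" for k
    proof -
      have sq_meas [measurable]: "(\<lambda>\<omega>. (\<xi> i \<omega>)\<^sup>2) \<in> borel_measurable N" if "i \<in> {1..k}" for i
        using squares_indep that by (auto simp: N.indep_vars_def)
      have "?cdf k = \<P>(\<omega> in N. (MAX i\<in>{1..k}. (\<xi> i \<omega>)\<^sup>2) \<le> c k * x + d k)"
        unfolding cdf_def using c_pos[OF k]
        by (subst measure_distr)
          (auto intro!: arg_cong[where f = N.prob] borel_measurable_times borel_measurable_diff
            borel_measurable_Max sq_meas simp: field_simps)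
      also have "\<dots> = (1 - tail (c k * x + d k)) ^ k"
        by (rule N.prob_Max_iid_le[OF squares_indep tail_eq k])
      finally show ?thesis .
    qed
    have "?cdf \<longlonglongrightarrow> exp (- exp (- x))"
      using mda by (simp only: weak_conv_m_std_gumbel_iff)
    then have "(\<lambda>n. ?cdf (?k n)) \<longlonglongrightarrow> exp (- exp (- x))"
      by (rule filterlim_compose[OF _ k_infty])
    then have "(\<lambda>n. (1 - tail (?u x n)) ^ ?k n) \<longlonglongrightarrow> exp (- exp (- x))"
      by (rule Lim_transform_eventually)
        (use k_pos in eventually_elim, rule cdf_eq)
    then show ?thesis
      by (subst (asm) power_one_minus_tendsto_exp_iff[OF k_infty]) (auto simp: tail_def)
  qed

  define D where "D n u = \<P>(\<omega> in M. sample_cov X n 1 1 \<omega> - real n * (\<integral>\<omega>. (X\<^sub>g \<omega>)\<^sup>2 \<partial>N) > u)" for n u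
  have D_bounds: "0 \<le> D n u" "D n u \<le> 1" for n u
    by (simp_all add: D_def)
  have diagonal_tail: "(\<lambda>n. real (p n) * D n (?u x n)) \<longlonglongrightarrow> exp (- x)" for x
  proof -
    have "(\<lambda>n. D n (?u x n) / (real n * tail (?u x n)) * (real (?k n) * tail (?u x n)))
        \<longlonglongrightarrow> 1 * exp (- x)"
      unfolding D_def tail_def by (intro tendsto_mult diag square_tail[unfolded tail_def])
    \<comment> \<open>positivity of the limit keeps the denominator \<open>n * tail\<close> away from the default \<open>z / 0 = 0\<close>\<close>
    moreover have "\<forall>\<^sub>F n in sequentially. 0 < real (?k n) * tail (?u x n)"
      by (rule order_tendstoD(1)[OF square_tail]) simp
    then have "\<forall>\<^sub>F n in sequentially.
        D n (?u x n) / (real n * tail (?u x n)) * (real (?k n) * tail (?u x n)) = real (p n) * D n (?u x n)"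
      by eventually_elim auto
    ultimately show ?thesis
      by (auto intro: Lim_transform_eventually)
  qed

  show ?thesis
  proof
    show "minus_infty_in_prob M
          (\<lambda>n \<omega>. inverse (c (n * p n)) *
            (MAX (i, j)\<in>{(i, j). 1 \<le> i \<and> i < j \<and> j \<le> p n}.
              (sample_cov X n i j \<omega> - real n * (\<integral>\<omega>. X\<^sub>g \<omega> \<partial>N)\<^sup>2) - d (n * p n)))"
      (is "minus_infty_in_prob M (\<lambda>n \<omega>. inverse (c (?k n)) * ?Max n \<omega>)")
      unfolding minus_infty_in_prob_def
    proof
      fix x
      let ?Q = "\<lambda>n. \<P>(\<omega> in M. sample_cov X n 1 2 \<omega> - real n * (\<integral>\<omega>. X\<^sub>g \<omega> \<partial>N)\<^sup>2 > ?u x n)"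
      obtain C where C: "\<forall>\<^sub>F n in sequentially.
            ?Q n \<le> C * real n * \<P>(\<omega> in N. \<xi> 1 \<omega> * \<xi> 2 \<omega> > ?u x n)"
          and small: "(\<lambda>n. C * real n * \<P>(\<omega> in N. \<xi> 1 \<omega> * \<xi> 2 \<omega> > ?u x n))
            \<in> o[sequentially](\<lambda>n. inverse ((real (p n))\<^sup>2))"
        using offdiag[of x] by blast
      let ?B = "\<lambda>n. C * real n * \<P>(\<omega> in N. \<xi> 1 \<omega> * \<xi> 2 \<omega> > ?u x n) / inverse ((real (p n))\<^sup>2)"
      have bound: "\<forall>\<^sub>F n in sequentially. \<P>(\<omega> in M. inverse (c (?k n)) * ?Max n \<omega> > x) \<le> ?B n"
        using C p_ge_2 k_pos
      proof eventually_elim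
        case (elim n)
        have "c (?k n) > 0"
          by (rule c_pos) (use elim in simp)
        then have "\<P>(\<omega> in M. inverse (c (?k n)) * ?Max n \<omega> > x) = \<P>(\<omega> in M. ?Max n \<omega> > c (?k n) * x)"
          by (simp add: field_simps)
        also have "\<dots> \<le> (real (p n))\<^sup>2 * ?Q n"
          using M.prob_Max_offdiagonal_le[OF rows elim(2)] .
        also have "\<dots> \<le> (real (p n))\<^sup>2 * (C * real n * \<P>(\<omega> in N. \<xi> 1 \<omega> * \<xi> 2 \<omega> > ?u x n))"
          by (rule mult_left_mono[OF elim(1)]) simp
        also have "\<dots> = ?B n"
          by (simp add: divide_inverse)
        finally show ?case .
      qed
      show "(\<lambda>n. \<P>(\<omega> in M. inverse (c (?k n)) * ?Max n \<omega> > x)) \<longlonglongrightarrow> 0"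
        by (rule tendsto_sandwich[OF _ bound tendsto_const smalloD_tendsto[OF small]]) simp
    qed

    show "weak_conv_m
          (\<lambda>n. distr M borel (\<lambda>\<omega>. inverse (c (n * p n)) *
            (MAX i\<in>{1..p n}.
              (sample_cov X n i i \<omega> - real n * (\<integral>\<omega>. (X\<^sub>g \<omega>)\<^sup>2 \<partial>N)) - d (n * p n))))
          std_gumbel"
      unfolding weak_conv_m_std_gumbel_iff
    proof
      fix x
      let ?a = "\<lambda>n. real n * (\<integral>\<omega>. (X\<^sub>g \<omega>)\<^sup>2 \<partial>N)"
      let ?Y = "\<lambda>n i \<omega>. sample_cov X n i i \<omega> - ?a n - d (?k n)"
      let ?cdf = "\<lambda>n. cdf (distr M borel (\<lambda>\<omega>. inverse (c (?k n)) * (MAX i\<in>{1..p n}. ?Y n i \<omega>))) x"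
      have cdf_eq: "(1 - D n (?u x n)) ^ p n = ?cdf n" if k: "1 \<le> ?k n" for n
      proof -
        have indep: "M.indep_vars (\<lambda>_. borel) (?Y n) {1..}"
          using M.iid_rows_imp_indep_vars_diagonal[OF rows, of n "?a n + d (?k n)"]
          by (simp add: diff_diff_eq)
        have Y_meas: "?Y n i \<in> borel_measurable M" if "i \<in> {1..p n}" for i
          using indep that by (auto simp: M.indep_vars_def)
        have Max_meas: "(\<lambda>\<omega>. inverse (c (?k n)) * (MAX i\<in>{1..p n}. ?Y n i \<omega>)) \<in> borel_measurable M"
          by (intro borel_measurable_times borel_measurable_const borel_measurable_Max Y_meas) simp_all
        have tails: "\<P>(\<omega> in M. ?Y n i \<omega> > c (?k n) * x) = D n (?u x n)" if "1 \<le> i" for i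
          using M.prob_diagonal_sample_cov_eq[OF rows that, where n = n and u = "?u x n + ?a n"]
          by (simp add: D_def less_diff_eq)
        have "?cdf n = \<P>(\<omega> in M. (MAX i\<in>{1..p n}. ?Y n i \<omega>) \<le> c (?k n) * x)"
          unfolding cdf_def using c_pos[OF k]
          by (subst measure_distr[OF Max_meas])
            (auto intro!: arg_cong[where f = M.prob] simp: field_simps)
        also have "\<dots> = (1 - D n (?u x n)) ^ p n"
          by (rule M.prob_Max_iid_le[OF indep tails]) (use k in \<open>auto simp: Suc_le_eq\<close>)
        finally show ?thesis ..
      qed
      have "(\<lambda>n. (1 - D n (?u x n)) ^ p n) \<longlonglongrightarrow> exp (- exp (- x))"
        using diagonal_tail[of x]
        by (subst power_one_minus_tendsto_exp_iff[OF p_infty]) (simp_all only: D_bounds)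
      then show "?cdf \<longlonglongrightarrow> exp (- exp (- x))"
        by (rule Lim_transform_eventually)
          (use k_pos in eventually_elim, rule cdf_eq)
    qed
  qed
qed

end
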